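(* Let $\mathbb K$ be a field of characteristic zero, $E$ a set, $n$ a non-negative integer, $f:[E]^1\to\mathbb K$ and $g:[E]^n\to\mathbb K$. If $f$ does not take the value $0$ on (the one-element subsets of) some subset of $E$ of size at least $2n+1$, and $fg=0$, then $g$ is identically zero on $[E]^n$.
   Context: $[X]^k$ is the set of $k$-element subsets of $X$. The product $fg:[E]^{n+1}\to\mathbb K$ is $(fg)(Q)=\sum_{x\in Q}f(\{x\})g(Q\setminus\{x\})$. *)

theory Defs
  imports "HOL-Library.Ramsey"
begin

text \<open>
  The set of \<open>k\<close>-element subsets of \<open>X\<close> is \<^term>\<open>nsets X k\<close>, written \<open>[X]\<^bsup>k\<^esup>\<close>. A function
  \<open>[E]\<^bsup>k\<^esup> \<rightarrow> K\<close> is represented by a total function on sets of which only the values on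
  \<open>[E]\<^bsup>k\<^esup>\<close> matter: for \<open>Q \<in> [E]\<^bsup>n+1\<^esup>\<close>, the value \<open>set_prod f g Q\<close> depends only on \<open>f\<close> on
  \<open>[E]\<^bsup>1\<^esup>\<close> and on \<open>g\<close> on \<open>[E]\<^bsup>n\<^esup>\<close>.
\<close>

definition set_prod :: "('a set \<Rightarrow> 'k::semiring_0) \<Rightarrow> ('a set \<Rightarrow> 'k) \<Rightarrow> 'a set \<Rightarrow> 'k"
  where "set_prod f g Q = (\<Sum>x\<in>Q. f {x} * g (Q - {x}))"

end

theory Submission
  imports Defs
begin

text \<open>
  Induction on \<open>n\<close>. For distinct \<open>x, y \<in> E\<close> the function
  \<open>g' S = f {y} * g (S \<union> {x}) - f {x} * g (S \<union> {y})\<close> on \<open>(n-1)\<close>-subsets of \<open>E - {x, y}\<close> satisfies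
  \<open>f g' = 0\<close>: evaluating \<open>f g = 0\<close> at \<open>Q \<union> {x}\<close> and at \<open>Q \<union> {y}\<close> produces the terms
  \<open>f {y} * f {x} * g Q\<close>, which cancel. Two points are removed, so the induction hypothesis gives
  \<open>g' = 0\<close>. Now for \<open>P\<close> and \<open>y \<notin> P\<close> with \<open>f {y} \<noteq> 0\<close>, every one of the \<open>n + 1\<close> summands of
  \<open>f g\<close> at \<open>P \<union> {y}\<close> equals \<open>f {y} * g P\<close>, whence \<open>(n + 1) * f {y} * g P = 0\<close>.
\<close>

lemma set_prod_insert:
  assumes "finite Q" "x \<notin> Q"
  shows "set_prod f g (insert x Q) = f {x} * g Q + (\<Sum>z\<in>Q. f {z} * g (insert x (Q - {z})))"
proof -
  have "f {z} * g (insert x Q - {z}) = f {z} * g (insert x (Q - {z}))" if "z \<in> Q" for z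
    using that assms(2) by (metis insert_Diff_if singletonD)
  then show ?thesis
    using assms by (simp add: set_prod_def)
qed

lemma insert_mem_nsets:
  assumes "Q \<in> [E]\<^bsup>k\<^esup>" "x \<in> E" "x \<notin> Q"
  shows "insert x Q \<in> [E]\<^bsup>Suc k\<^esup>"
  using assms by (auto simp: nsets_def)

lemma set_prod_swap_difference:
  fixes f g :: "'a set \<Rightarrow> 'k::comm_ring"
  assumes "finite Q" "x \<notin> Q" "y \<notin> Q"
    and "set_prod f g (insert x Q) = 0" "set_prod f g (insert y Q) = 0"
  shows "set_prod f (\<lambda>S. f {y} * g (insert x S) - f {x} * g (insert y S)) Q = 0"
proof -
  have "set_prod f (\<lambda>S. f {y} * g (insert x S) - f {x} * g (insert y S)) Q
      = f {y} * (\<Sum>z\<in>Q. f {z} * g (insert x (Q - {z})))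
        - f {x} * (\<Sum>z\<in>Q. f {z} * g (insert y (Q - {z})))"
    by (simp add: set_prod_def sum_distrib_left sum_subtractf algebra_simps)
  also have "\<dots> = f {y} * set_prod f g (insert x Q) - f {x} * set_prod f g (insert y Q)"
    using assms(1-3) by (simp add: set_prod_insert algebra_simps)
  finally show ?thesis
    using assms(4,5) by simp
qed

lemma set_prod_cancel:
  fixes f g :: "'a set \<Rightarrow> 'k::field_char_0"
  assumes "A \<subseteq> E" "finite A" "2 * n + 1 \<le> card A" "\<And>x. x \<in> A \<Longrightarrow> f {x} \<noteq> 0"
    and "\<And>Q. Q \<in> [E]\<^bsup>Suc n\<^esup> \<Longrightarrow> set_prod f g Q = 0"
    and "P \<in> [E]\<^bsup>n\<^esup>"
  shows "g P = 0"
  using assms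
\<comment> \<open>Only \<open>f\<close> stays fixed: the induction hypothesis is used for a smaller
  \<open>E\<close> and for a function built from \<open>g\<close>.\<close>
proof (induction n arbitrary: A E g P)
  case 0
  then obtain y where y: "y \<in> A"
    by fastforce
  \<comment> \<open>The single summand is \<open>f {y} * g {}\<close>, and \<open>P\<close> can only
    be \<open>{}\<close>.\<close>
  have "set_prod f g {y} = 0"
    using 0 y by (intro 0(5)) (auto simp: nsets_def)
  with 0 y show ?case
    by (auto simp: set_prod_def nsets_def)
next
  case (Suc n)
  have P: "finite P" "card P = Suc n" "P \<subseteq> E"
    using Suc.prems(6) by (auto simp: nsets_def)
  have swap: "f {y} * g (insert x S) = f {x} * g (insert y S)"
    if "x \<in> E" "y \<in> E" "S \<in> [E - {x, y}]\<^bsup>n\<^esup>" for x y S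
  proof -
    \<comment> \<open>\<open>x\<close> and \<open>y\<close> may coincide or lie outside
      \<open>A\<close>; at most two of its at least \<open>2 * n + 3\<close> points are
      lost.\<close>
    have "card A - card {x, y} \<le> card (A - {x, y})"
      by (rule diff_card_le_card_Diff) simp
    moreover have "card {x, y} \<le> 2"
      by (simp add: card_insert_if)
    ultimately have "2 * n + 1 \<le> card (A - {x, y})"
      using Suc.prems(3) by arith
    moreover have "set_prod f (\<lambda>S. f {y} * g (insert x S) - f {x} * g (insert y S)) Q = 0"
      if "Q \<in> [E - {x, y}]\<^bsup>Suc n\<^esup>" for Q
    proof -
      have "Q \<in> [E]\<^bsup>Suc n\<^esup>" "finite Q" "x \<notin> Q" "y \<notin> Q"
        using that by (auto simp: nsets_def)
      with \<open>x \<in> E\<close> \<open>y \<in> E\<close> show ?thesis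
        by (intro set_prod_swap_difference Suc.prems(5) insert_mem_nsets)
    qed
    ultimately have "f {y} * g (insert x S) - f {x} * g (insert y S) = 0"
      using Suc.prems(1,2,4) that(3)
      by (intro Suc.IH[of "A - {x, y}" "E - {x, y}"
            "\<lambda>S. f {y} * g (insert x S) - f {x} * g (insert y S)"]) auto
    then show ?thesis by simp
  qed
  have "\<not> A \<subseteq> P"
    using card_mono[of P A] P Suc.prems(3) by auto
  then obtain y where y: "y \<in> A" "y \<notin> P" by blast
  have term_eq: "f {x} * g (insert y (P - {x})) = f {y} * g P" if "x \<in> P" for x
  proof -
    have "P - {x} \<in> [E - {x, y}]\<^bsup>n\<^esup>"
      using that P y by (auto simp: nsets_def)
    then show ?thesis
      using swap[of x y "P - {x}"] that P y Suc.prems(1) by (metis insert_Diff subsetD)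
  qed
  have "0 = set_prod f g (insert y P)"
    using y Suc.prems(1,5,6) insert_mem_nsets[of P E "Suc n" y] by auto
  \<comment> \<open>One summand comes from \<open>y\<close> and \<open>n + 1\<close> from
    \<open>P\<close>; characteristic zero makes the factor nonzero.\<close>
  also have "\<dots> = of_nat (n + 2) * (f {y} * g P)"
    using P y by (simp add: set_prod_insert term_eq algebra_simps)
  finally show ?case
    using Suc.prems(4)[OF y(1)] of_nat_neq_0[of "Suc n", where ?'a = 'k] by simp
qed

theorem theorem13:
  fixes E :: "'a set" and n :: nat
    and f g :: "'a set \<Rightarrow> 'k::field_char_0"
  assumes "\<exists>A\<subseteq>E. (infinite A \<or> card A \<ge> 2 * n + 1) \<and> (\<forall>P\<in>[A]\<^bsup>1\<^esup>. f P \<noteq> 0)"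
    and "\<forall>Q\<in>[E]\<^bsup>(n + 1)\<^esup>. set_prod f g Q = 0"
  shows "\<forall>P\<in>[E]\<^bsup>n\<^esup>. g P = 0"
proof -
  obtain A where A: "A \<subseteq> E" "infinite A \<or> card A \<ge> 2 * n + 1" "\<forall>P\<in>[A]\<^bsup>1\<^esup>. f P \<noteq> 0"
    using assms(1) by blast
  \<comment> \<open>A finite \<open>B\<close> is needed because \<open>card\<close> is 0 on infinite
    sets.\<close>
  obtain B where B: "B \<subseteq> A" "finite B" "card B = 2 * n + 1"
    using A(2) by (meson infinite_arbitrarily_large obtain_subset_with_card_n)
  have "f {x} \<noteq> 0" if "x \<in> B" for x
    using A(3) B(1) that by (auto simp: nsets_def)
  then show ?thesis
    using set_prod_cancel[of B E n f g] A(1) B assms(2) by auto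
qed

end
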